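(* For every real Banach space $X$ with $\dim X\ge2$ and every $-\infty\le t<\infty$, $$C^B_t(X)\le1+\bigl(1-2\delta_B^+(X)\bigr)^2.$$
   Context: $S_X$ denotes the unit sphere of $X$. For $x,y\in X$, Birkhoff-James orthogonality $x\perp_B y$ means $\|x+\lambda y\|\ge\|x\|$ for all $\lambda\in\mathbb{R}$. For $a,b>0$ set $M_t(a,b)=\left(\frac{a^t+b^t}{2}\right)^{1/t}$ if $t\in\mathbb{R}\setminus\{0\}$, $M_0(a,b)=\sqrt{ab}$, and $M_{-\infty}(a,b)=\min\{a,b\}$. For $-\infty\le t<\infty$ and $\tau\ge 0$ define $$J^B_{X,t}(\tau)=\sup\{M_t(\|x+\tau y\|,\|x-\tau y\|): x,y\in S_X,\ x\perp_B y\},\qquad C^B_t(X)=\sup_{0\le\tau\le1}\frac{J^B_{X,t}(\tau)^2}{1+\tau^2}.$$ Define $$\delta_B^+(X)=\inf\left\{1-\frac{\|x+y\|}{2}:x,y\in S_X,\ x\perp_B y\right\}.$$ *)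

theory Defs
  imports "HOL-Analysis.Analysis"
begin

definition birkhoff_orthogonal :: "'a::real_normed_vector \<Rightarrow> 'a \<Rightarrow> bool"
    (infix "\<bottom>\<^sub>B" 50) where
  "x \<bottom>\<^sub>B y \<longleftrightarrow> (\<forall>l::real. norm (x + l *\<^sub>R y) \<ge> norm x)"

text \<open>
  The exponent ranges over the extended reals so that the mean of order minus infinity is included.
  The value at plus infinity only makes the definition total.
\<close>

definition power_mean :: "ereal \<Rightarrow> real \<Rightarrow> real \<Rightarrow> real" where
  "power_mean t a b =
     (case t of
        ereal r \<Rightarrow> if r = 0 then sqrt (a * b) else ((a powr r + b powr r) / 2) powr (1 / r)
      | PInfty \<Rightarrow> max a b
      | MInfty \<Rightarrow> min a b)"

text \<open>
  The suprema and infima below are taken in the reals. When the dimension is at least 2 they range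
  over nonempty bounded sets: Birkhoff-orthogonal unit vectors exist, and for such \<open>x\<close> and \<open>y\<close> and
  \<open>0 \<le> \<tau>\<close> both norms lie between \<open>1\<close> and \<open>1 + \<tau>\<close>, hence so does their mean.
\<close>

definition J_B :: "'a::real_normed_vector itself \<Rightarrow> ereal \<Rightarrow> real \<Rightarrow> real" where
  "J_B X t \<tau> =
     Sup {power_mean t (norm (x + \<tau> *\<^sub>R y)) (norm (x - \<tau> *\<^sub>R y)) | x y :: 'a.
            x \<in> sphere 0 1 \<and> y \<in> sphere 0 1 \<and> x \<bottom>\<^sub>B y}"

definition C_B :: "'a::real_normed_vector itself \<Rightarrow> ereal \<Rightarrow> real" where
  "C_B X t = (SUP \<tau>\<in>{0..1}. (J_B X t \<tau>)\<^sup>2 / (1 + \<tau>\<^sup>2))"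

definition delta_B_plus :: "'a::real_normed_vector itself \<Rightarrow> real" where
  "delta_B_plus X =
     Inf {1 - norm (x + y) / 2 | x y :: 'a.
            x \<in> sphere 0 1 \<and> y \<in> sphere 0 1 \<and> x \<bottom>\<^sub>B y}"

text \<open>
  Dimension at least \<open>n\<close>, allowing infinite dimension. The library's \<open>dim\<close> is \<open>0\<close> on an
  infinite-dimensional space, so it cannot be used here.
\<close>

definition dim_at_least :: "'a::real_vector itself \<Rightarrow> nat \<Rightarrow> bool" where
  "dim_at_least X n \<longleftrightarrow> (\<exists>B::'a set. finite B \<and> independent B \<and> card B = n)"

end

theory Submission
  imports Defs
begin

text \<open>
  Put \<open>s = 2 - 2\<delta>\<close>, the supremum of \<open>\<parallel>x + y\<parallel>\<close> over Birkhoff-orthogonal unit vectors. Since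
  \<open>x + \<tau>y = (1 - \<tau>)x + \<tau>(x + y)\<close>, and orthogonality is preserved under \<open>y \<mapsto> -y\<close>, both norms
  \<open>\<parallel>x \<plusminus> \<tau>y\<parallel>\<close>, hence every mean of them, are at most \<open>1 + \<tau>(s - 1)\<close>. By Cauchy-Schwarz,
  \<open>(1 + \<tau>(s - 1))\<^sup>2 \<le> (1 + \<tau>\<^sup>2)(1 + (s - 1)\<^sup>2)\<close>.
\<close>

lemma birkhoff_orthogonal_minus_right:
  "x \<bottom>\<^sub>B y \<Longrightarrow> x \<bottom>\<^sub>B - y"
  unfolding birkhoff_orthogonal_def
  by (metis scaleR_minus_left scaleR_minus_right)

text \<open>Pulling \<open>a\<close> out of the norm turns the coefficient \<open>l * b\<close> into
  \<open>l * b / a\<close>, which the hypothesis covers since it holds for all reals. This is what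
  permits normalising an orthogonal pair to unit vectors.\<close>

lemma birkhoff_orthogonal_scaleR:
  assumes "x \<bottom>\<^sub>B y"
  shows "a *\<^sub>R x \<bottom>\<^sub>B b *\<^sub>R y"
proof (cases "a = 0")
  case True
  then show ?thesis by (simp add: birkhoff_orthogonal_def)
next
  case False
  have "norm (a *\<^sub>R x) \<le> norm (a *\<^sub>R x + l *\<^sub>R (b *\<^sub>R y))" for l
  proof -
    have "norm x \<le> norm (x + (l * b / a) *\<^sub>R y)"
      using assms by (simp add: birkhoff_orthogonal_def)
    then have "\<bar>a\<bar> * norm x \<le> \<bar>a\<bar> * norm (x + (l * b / a) *\<^sub>R y)"
      by (simp add: mult_left_mono)
    also have "\<dots> = norm (a *\<^sub>R x + l *\<^sub>R (b *\<^sub>R y))"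
      unfolding norm_scaleR [symmetric] using False by (simp add: scaleR_add_right)
    finally show ?thesis by simp
  qed
  then show ?thesis by (simp add: birkhoff_orthogonal_def)
qed

text \<open>Orthogonality to \<open>v\<close> says that the norm is minimal along the line in
  direction \<open>v\<close>; so the point of the line through \<open>u\<close> that is nearest to
  the origin will do.\<close>

lemma ex_birkhoff_orthogonal_translate:
  fixes u v :: "'a::real_normed_vector"
  assumes "v \<noteq> 0"
  shows "\<exists>l. u + l *\<^sub>R v \<bottom>\<^sub>B v"
proof -
  \<comment> \<open>Beyond this radius \<open>norm (k *\<^sub>R v)\<close> is at least
    \<open>2 * norm u\<close>, so the norm on the line is at least \<open>norm u\<close>, its value
    at \<open>k = 0\<close>. Hence a minimum over the compact interval is global.\<close>
  define R where "R = 2 * norm u / norm v"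
  have R: "0 \<le> R" by (simp add: R_def)
  have "continuous_on {-R..R} (\<lambda>l. norm (u + l *\<^sub>R v))"
    by (intro continuous_intros)
  then obtain l where l: "\<And>k. k \<in> {-R..R} \<Longrightarrow> norm (u + l *\<^sub>R v) \<le> norm (u + k *\<^sub>R v)"
    using continuous_attains_inf [of "{-R..R}" "\<lambda>l. norm (u + l *\<^sub>R v)"] R
    by (metis compact_Icc atLeastAtMost_iff empty_iff neg_le_0_iff_le)
  have min: "norm (u + l *\<^sub>R v) \<le> norm (u + k *\<^sub>R v)" for k
  proof (cases "k \<in> {-R..R}")
    case False
    then have "R * norm v \<le> \<bar>k\<bar> * norm v"
      by (intro mult_right_mono) auto
    then have "2 * norm u \<le> norm (k *\<^sub>R v)"
      using assms by (simp add: R_def)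
    then have "norm u \<le> norm (u + k *\<^sub>R v)"
      using norm_diff_ineq [of "k *\<^sub>R v" u] by (simp add: add.commute)
    then show ?thesis
      using l [of 0] R by simp
  qed (rule l)
  have "norm (u + l *\<^sub>R v) \<le> norm (u + l *\<^sub>R v + k *\<^sub>R v)" for k
    using min [of "l + k"] by (simp add: algebra_simps)
  then show ?thesis
    unfolding birkhoff_orthogonal_def by blast
qed

text \<open>This makes the set under the supremum in \<open>J_B\<close> nonempty; the dimension
  enters here, through a vector \<open>u\<close> outside the line spanned by
  \<open>v\<close>.\<close>

lemma ex_birkhoff_orthogonal_unit:
  assumes "dim_at_least TYPE('a::real_normed_vector) 2"
  shows "\<exists>x y :: 'a. x \<in> sphere 0 1 \<and> y \<in> sphere 0 1 \<and> x \<bottom>\<^sub>B y"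
proof -
  obtain u v :: 'a where uv: "independent {u, v}" "u \<noteq> v"
    using assms unfolding dim_at_least_def by (metis card_2_iff)
  then have v: "v \<noteq> 0" and u: "u \<notin> span {v}"
    using dependent_zero [of "{u, v}"] by (auto simp: independent_insert)
  obtain l where l: "u + l *\<^sub>R v \<bottom>\<^sub>B v"
    using ex_birkhoff_orthogonal_translate [OF v] by blast
  define w where "w = u + l *\<^sub>R v"
  have w: "w \<noteq> 0"
  proof
    assume "w = 0"
    then have "u = (- l) *\<^sub>R v"
      by (simp add: w_def eq_neg_iff_add_eq_0)
    then show False
      using u by (metis insertI1 span_base span_scale)
  qed
  have "(1 / norm w) *\<^sub>R w \<bottom>\<^sub>B (1 / norm v) *\<^sub>R v"
    using l unfolding w_def by (rule birkhoff_orthogonal_scaleR)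
  then show ?thesis
    using v w by (intro exI [of _ "(1 / norm w) *\<^sub>R w"] exI [of _ "(1 / norm v) *\<^sub>R v"]) simp
qed

lemma power_mean_nonneg:
  assumes "0 \<le> a" "0 \<le> b"
  shows "0 \<le> power_mean t a b"
  using assms by (cases t) (auto simp: power_mean_def)

text \<open>The mean is monotone in both arguments and the mean of \<open>c\<close> and
  \<open>c\<close> is \<open>c\<close>. Strict positivity matters for negative exponents: since
  \<open>0 powr r = 0\<close>, the values \<open>a = 0\<close>, \<open>b = c\<close>,
  \<open>r = -1\<close> would give \<open>2 * c\<close>.\<close>

lemma power_mean_le:
  assumes "0 < a" "a \<le> c" "0 < b" "b \<le> c"
  shows "power_mean t a b \<le> c"
proof (cases t)
  case (real r)
  have c: "0 < c" using assms by linarith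
  consider "r = 0" | "0 < r" | "r < 0" by linarith
  then show ?thesis
  proof cases
    case 1
    have "sqrt (a * b) \<le> sqrt (c * c)"
      using assms by (intro real_sqrt_le_mono mult_mono) auto
    then show ?thesis
      using 1 real c by (simp add: power_mean_def)
  next
    case 2
    have "a powr r \<le> c powr r" "b powr r \<le> c powr r"
      using assms 2 by (auto intro!: powr_mono2)
    then have "((a powr r + b powr r) / 2) powr (1 / r) \<le> (c powr r) powr (1 / r)"
      using 2 by (intro powr_mono2) auto
    then show ?thesis
      using 2 real c by (simp add: power_mean_def powr_powr)
  next
    case 3
    \<comment> \<open>Both \<open>r\<close> and \<open>1 / r\<close> are negative, so the order is
      reversed twice.\<close>
    have "c powr r \<le> a powr r" "c powr r \<le> b powr r"
      using assms 3 by (auto intro!: powr_mono2')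
    then have "((a powr r + b powr r) / 2) powr (1 / r) \<le> (c powr r) powr (1 / r)"
      using 3 c by (intro powr_mono2') (auto simp: divide_nonpos_neg)
    then show ?thesis
      using 3 real c by (simp add: power_mean_def powr_powr)
  qed
qed (use assms in \<open>auto simp: power_mean_def\<close>)

lemma norm_add_le_delta_B_plus:
  fixes x y :: "'a::real_normed_vector"
  assumes "x \<in> sphere 0 1" "y \<in> sphere 0 1" "x \<bottom>\<^sub>B y"
  shows "norm (x + y) \<le> 2 - 2 * delta_B_plus TYPE('a)"
proof -
  have "delta_B_plus TYPE('a) \<le> 1 - norm (x + y) / 2"
    unfolding delta_B_plus_def
  proof (rule cInf_lower)
    \<comment> \<open>The triangle inequality bounds the set below, so that its real infimum is a
      genuine lower bound.\<close>
    have "0 \<le> 1 - norm (x + y) / 2" if "norm x = 1" "norm y = 1" for x y :: 'a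
      using norm_triangle_ineq [of x y] that by simp
    then show "bdd_below {1 - norm (x + y) / 2 | x y :: 'a.
        x \<in> sphere 0 1 \<and> y \<in> sphere 0 1 \<and> x \<bottom>\<^sub>B y}"
      by (intro bdd_belowI [of _ 0]) auto
  qed (use assms in blast)
  then show ?thesis by simp
qed

lemma norm_add_scaleR_le_delta_B_plus:
  fixes x y :: "'a::real_normed_vector"
  assumes "x \<in> sphere 0 1" "y \<in> sphere 0 1" "x \<bottom>\<^sub>B y" "0 \<le> \<tau>" "\<tau> \<le> 1"
  shows "norm (x + \<tau> *\<^sub>R y) \<le> 1 + \<tau> * (1 - 2 * delta_B_plus TYPE('a))"
proof -
  have "x + \<tau> *\<^sub>R y = (1 - \<tau>) *\<^sub>R x + \<tau> *\<^sub>R (x + y)"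
    by (simp add: algebra_simps)
  then have "norm (x + \<tau> *\<^sub>R y) \<le> (1 - \<tau>) * norm x + \<tau> * norm (x + y)"
    using norm_triangle_ineq [of "(1 - \<tau>) *\<^sub>R x" "\<tau> *\<^sub>R (x + y)"] assms by simp
  also have "\<dots> \<le> (1 - \<tau>) * 1 + \<tau> * (2 - 2 * delta_B_plus TYPE('a))"
    using assms norm_add_le_delta_B_plus [of x y] by (intro add_mono mult_left_mono) auto
  finally show ?thesis by (simp add: algebra_simps)
qed

lemma power_mean_norm_le_delta_B_plus:
  fixes x y :: "'a::real_normed_vector"
  assumes "x \<in> sphere 0 1" "y \<in> sphere 0 1" "x \<bottom>\<^sub>B y" "0 \<le> \<tau>" "\<tau> \<le> 1"
  shows "power_mean t (norm (x + \<tau> *\<^sub>R y)) (norm (x - \<tau> *\<^sub>R y))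
    \<le> 1 + \<tau> * (1 - 2 * delta_B_plus TYPE('a))"
proof (rule power_mean_le)
  have ge: "norm x \<le> norm (x + k *\<^sub>R y)" for k
    using assms(3) by (simp add: birkhoff_orthogonal_def)
  \<comment> \<open>Orthogonality keeps both norms at least \<open>norm x = 1\<close>.\<close>
  show "0 < norm (x + \<tau> *\<^sub>R y)" "0 < norm (x - \<tau> *\<^sub>R y)"
    using ge [of \<tau>] ge [of "- \<tau>"] assms(1) by auto
  show "norm (x + \<tau> *\<^sub>R y) \<le> 1 + \<tau> * (1 - 2 * delta_B_plus TYPE('a))"
    using assms by (rule norm_add_scaleR_le_delta_B_plus)
  show "norm (x - \<tau> *\<^sub>R y) \<le> 1 + \<tau> * (1 - 2 * delta_B_plus TYPE('a))"
    using norm_add_scaleR_le_delta_B_plus [of x "- y" \<tau>] assms birkhoff_orthogonal_minus_right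
    by auto
qed

text \<open>The lower bound is there so that the upper bound can be squared.\<close>

lemma J_B_bounds:
  assumes "dim_at_least TYPE('a::real_normed_vector) 2" "0 \<le> \<tau>" "\<tau> \<le> 1"
  shows "0 \<le> J_B TYPE('a) t \<tau>"
    and "J_B TYPE('a) t \<tau> \<le> 1 + \<tau> * (1 - 2 * delta_B_plus TYPE('a))"
proof -
  let ?S = "{power_mean t (norm (x + \<tau> *\<^sub>R y)) (norm (x - \<tau> *\<^sub>R y)) | x y :: 'a.
            x \<in> sphere 0 1 \<and> y \<in> sphere 0 1 \<and> x \<bottom>\<^sub>B y}"
  have le: "z \<le> 1 + \<tau> * (1 - 2 * delta_B_plus TYPE('a))" if "z \<in> ?S" for z
    using that power_mean_norm_le_delta_B_plus assms(2,3) by blast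
  obtain z where z: "z \<in> ?S"
    using ex_birkhoff_orthogonal_unit [OF assms(1)] by blast
  then have "0 \<le> z"
    by (auto intro!: power_mean_nonneg)
  also have "z \<le> J_B TYPE('a) t \<tau>"
    unfolding J_B_def using z le by (rule cSup_upper [OF _ bdd_aboveI])
  finally show "0 \<le> J_B TYPE('a) t \<tau>" .
  show "J_B TYPE('a) t \<tau> \<le> 1 + \<tau> * (1 - 2 * delta_B_plus TYPE('a))"
    unfolding J_B_def using z le by (intro cSup_least) blast+
qed

theorem proposition11:
  fixes t :: ereal
  assumes "dim_at_least TYPE('a::banach) 2"
    and "t < \<infinity>"
  shows "C_B TYPE('a) t \<le> 1 + (1 - 2 * delta_B_plus TYPE('a))\<^sup>2"
  unfolding C_B_def
proof (rule cSUP_least)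
  let ?d = "1 - 2 * delta_B_plus TYPE('a)"
  fix \<tau> :: real
  assume "\<tau> \<in> {0..1}"
  then have "(J_B TYPE('a) t \<tau>)\<^sup>2 \<le> (1 + \<tau> * ?d)\<^sup>2"
    using J_B_bounds [OF assms(1)] by (intro power_mono) auto
  also have "\<dots> \<le> (1 + ?d\<^sup>2) * (1 + \<tau>\<^sup>2)"
    \<comment> \<open>The difference of the two sides is exactly
      \<open>(\<tau> - ?d)\<^sup>2\<close>.\<close>
    using zero_le_power2 [of "\<tau> - ?d"] by (simp add: power2_eq_square algebra_simps)
  finally show "(J_B TYPE('a) t \<tau>)\<^sup>2 / (1 + \<tau>\<^sup>2) \<le> 1 + ?d\<^sup>2"
    by (simp add: pos_divide_le_eq add_pos_nonneg)
qed simp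

end
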